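(* Let $X$ and $Y$ be Banach spaces and let $Z=X\oplus_\infty Y$. If $Z$ has $BSCSP$, then both $X$ and $Y$ have $BSCSP$.
   Context: All Banach spaces are real and nontrivial. For a Banach space $E$, $B_E$ is the closed unit ball and $S_E$ the unit sphere. A slice of $B_E$ is a set $S(B_E,x^*,\alpha)=\{x\in B_E: x^*(x)>1-\alpha\}$ with $x^*\in S_{E^*}$ and $\alpha>0$. A convex combination of slices of $B_E$ is a set $\sum_{i=1}^n\lambda_i S_i$ (Minkowski sum), where each $S_i$ is a slice of $B_E$, $\lambda_i\ge 0$ and $\sum_{i=1}^n\lambda_i=1$. $E$ has the Ball Small Combination of Slice Property ($BSCSP$) if for every $\varepsilon>0$ there is a convex combination of slices of $B_E$ with diameter less than $\varepsilon$. $X\oplus_\infty Y$ is $X\times Y$ with norm $\|(x,y)\|=\max\{\|x\|,\|y\|\}$. *)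

theory Defs
  imports "HOL-Analysis.Analysis"
begin

text \<open>The library norm on \<open>'a \<times> 'b\<close> is the Euclidean one, so the max-norm direct sum
  needs its own type.\<close>

datatype ('a, 'b) linf_sum = Linf (lfst: 'a) (lsnd: 'b)

instantiation linf_sum :: (real_vector, real_vector) real_vector
begin

definition zero_linf_sum :: "('a, 'b) linf_sum" where
  "0 = Linf 0 0"

definition plus_linf_sum :: "('a, 'b) linf_sum \<Rightarrow> ('a, 'b) linf_sum \<Rightarrow> ('a, 'b) linf_sum" where
  "z + w = Linf (lfst z + lfst w) (lsnd z + lsnd w)"

definition uminus_linf_sum :: "('a, 'b) linf_sum \<Rightarrow> ('a, 'b) linf_sum" where
  "- z = Linf (- lfst z) (- lsnd z)"

definition minus_linf_sum :: "('a, 'b) linf_sum \<Rightarrow> ('a, 'b) linf_sum \<Rightarrow> ('a, 'b) linf_sum" where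
  "z - w = Linf (lfst z - lfst w) (lsnd z - lsnd w)"

definition scaleR_linf_sum :: "real \<Rightarrow> ('a, 'b) linf_sum \<Rightarrow> ('a, 'b) linf_sum" where
  "c *\<^sub>R z = Linf (c *\<^sub>R lfst z) (c *\<^sub>R lsnd z)"

instance
  by standard
    (simp_all add: zero_linf_sum_def plus_linf_sum_def uminus_linf_sum_def minus_linf_sum_def
      scaleR_linf_sum_def algebra_simps)

end

lemma lfst_simps [simp]:
  "lfst 0 = 0" "lfst (z + w) = lfst z + lfst w" "lfst (- z) = - lfst z"
  "lfst (z - w) = lfst z - lfst w" "lfst (c *\<^sub>R z) = c *\<^sub>R lfst z"
  by (simp_all add: zero_linf_sum_def plus_linf_sum_def uminus_linf_sum_def minus_linf_sum_def
      scaleR_linf_sum_def)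

lemma lsnd_simps [simp]:
  "lsnd 0 = 0" "lsnd (z + w) = lsnd z + lsnd w" "lsnd (- z) = - lsnd z"
  "lsnd (z - w) = lsnd z - lsnd w" "lsnd (c *\<^sub>R z) = c *\<^sub>R lsnd z"
  by (simp_all add: zero_linf_sum_def plus_linf_sum_def uminus_linf_sum_def minus_linf_sum_def
      scaleR_linf_sum_def)

instantiation linf_sum :: (real_normed_vector, real_normed_vector) real_normed_vector
begin

definition norm_linf_sum :: "('a, 'b) linf_sum \<Rightarrow> real" where
  "norm z = max (norm (lfst z)) (norm (lsnd z))"

definition dist_linf_sum :: "('a, 'b) linf_sum \<Rightarrow> ('a, 'b) linf_sum \<Rightarrow> real" where
  "dist_linf_sum z w = norm (z - w)"

definition sgn_linf_sum :: "('a, 'b) linf_sum \<Rightarrow> ('a, 'b) linf_sum" where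
  "sgn_linf_sum z = inverse (norm z) *\<^sub>R z"

definition uniformity_linf_sum :: "(('a, 'b) linf_sum \<times> ('a, 'b) linf_sum) filter" where
  "uniformity_linf_sum = (INF e\<in>{0<..}. principal {(z, w). dist z w < e})"

definition open_linf_sum :: "('a, 'b) linf_sum set \<Rightarrow> bool" where
  "open_linf_sum U \<longleftrightarrow> (\<forall>z\<in>U. eventually (\<lambda>(z', w). z' = z \<longrightarrow> w \<in> U) uniformity)"

instance
proof
  fix z w :: "('a, 'b) linf_sum" and c :: real and U :: "('a, 'b) linf_sum set"
  show "dist z w = norm (z - w)"
    by (rule dist_linf_sum_def)
  show "sgn z = z /\<^sub>R norm z"
    by (simp add: sgn_linf_sum_def)
  show "uniformity = (INF e\<in>{0<..}. principal {(x::('a, 'b) linf_sum, y). dist x y < e})"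
    by (rule uniformity_linf_sum_def)
  show "open U \<longleftrightarrow> (\<forall>z\<in>U. eventually (\<lambda>(z', w). z' = z \<longrightarrow> w \<in> U) uniformity)"
    by (rule open_linf_sum_def)
  show "norm z = 0 \<longleftrightarrow> z = 0"
    by (cases z) (auto simp: norm_linf_sum_def zero_linf_sum_def max_def)
  show "norm (z + w) \<le> norm z + norm w"
    unfolding norm_linf_sum_def
    using norm_triangle_ineq[of "lfst z" "lfst w"] norm_triangle_ineq[of "lsnd z" "lsnd w"]
    by (simp add: max_def)
  show "norm (c *\<^sub>R z) = \<bar>c\<bar> * norm z"
    by (simp add: norm_linf_sum_def max_mult_distrib_left)
qed

end

instance linf_sum :: (banach, banach) banach
proof
  fix X :: "nat \<Rightarrow> ('a, 'b) linf_sum"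
  assume X: "Cauchy X"
  have 1: "dist (lfst z) (lfst w) \<le> dist z w" and 2: "dist (lsnd z) (lsnd w) \<le> dist z w"
    for z w :: "('a, 'b) linf_sum"
    by (simp_all add: dist_norm norm_linf_sum_def)
  have "Cauchy (\<lambda>n. lfst (X n))" "Cauchy (\<lambda>n. lsnd (X n))"
    using X 1 2 unfolding Cauchy_def by (meson le_less_trans)+
  then obtain a b where ab: "(\<lambda>n. lfst (X n)) \<longlonglongrightarrow> a" "(\<lambda>n. lsnd (X n)) \<longlonglongrightarrow> b"
    by (auto simp: Cauchy_convergent_iff convergent_def)
  have "(\<lambda>n. max (norm (lfst (X n) - a)) (norm (lsnd (X n) - b))) \<longlonglongrightarrow> max 0 0"
    using ab by (intro tendsto_max tendsto_norm_zero) (auto simp: LIM_zero_iff)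
  then have "(\<lambda>n. norm (X n - Linf a b)) \<longlonglongrightarrow> 0"
    by (simp add: norm_linf_sum_def)
  then have "X \<longlonglongrightarrow> Linf a b"
    by (simp add: tendsto_norm_zero_iff LIM_zero_iff)
  then show "convergent X"
    by (auto simp: convergent_def)
qed

definition slice :: "('a::real_normed_vector \<Rightarrow>\<^sub>L real) \<Rightarrow> real \<Rightarrow> 'a set" where
  "slice f \<alpha> = {x \<in> cball 0 1. blinfun_apply f x > 1 - \<alpha>}"

definition is_slice :: "'a::real_normed_vector set \<Rightarrow> bool" where
  "is_slice S \<longleftrightarrow> (\<exists>f \<alpha>. norm f = 1 \<and> \<alpha> > 0 \<and> S = slice f \<alpha>)"

definition is_convex_combination_of_slices :: "'a::real_normed_vector set \<Rightarrow> bool" where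
  "is_convex_combination_of_slices C \<longleftrightarrow>
    (\<exists>(n::nat) (c :: nat \<Rightarrow> real) (S :: nat \<Rightarrow> 'a set).
      (\<forall>i<n. is_slice (S i)) \<and> (\<forall>i<n. 0 \<le> c i) \<and> (\<Sum>i<n. c i) = 1 \<and>
      C = {\<Sum>i<n. c i *\<^sub>R x i | x. \<forall>i<n. x i \<in> S i})"

text \<open>The property belongs to the whole space, hence is a predicate on types. The diameters are
  meaningful: every convex combination of slices is nonempty and contained in the unit ball.\<close>

definition BSCSP :: "'a::real_normed_vector itself \<Rightarrow> bool" where
  "BSCSP _ \<longleftrightarrow>
    (\<forall>\<epsilon>>0. \<exists>C :: 'a set. is_convex_combination_of_slices C \<and> diameter C < \<epsilon>)"

end

(* Write Z as the max-norm sum of X and Y. For f in the unit sphere of Z* with restrictions g to X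
   and h to Y we have norm g + norm h = 1. Fix y in the ball of Y with h y > norm h - a/2; then x + y
   lies in the slice given by f and a whenever x is in the ball of X and g x > norm g - a/2. The
   latter set is a slice of X, or the whole ball if g = 0. Hence a convex combination of slices of Z
   contains a translate of a convex combination of slices of X with the same coefficients. The case
   in which every restriction g vanishes needs no Hahn-Banach theorem: the given combination then
   contains a translate of the unit ball of X and has diameter at least 2. *)

theory Submission
  imports Defs
begin

text \<open>The unit ball is symmetric, so by homogeneity a one-sided bound for \<open>h\<close> on
  the ball bounds \<bar>h\<bar> as well. A bound \<open>norm h - \<delta>\<close> would thus be an
  operator bound smaller than \<open>norm h\<close>.\<close>

lemma blinfun_almost_attains_norm:
  fixes h :: "'a::real_normed_vector \<Rightarrow>\<^sub>L real"
  assumes "\<delta> > 0"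
  obtains y where "norm y \<le> 1" "blinfun_apply h y > norm h - \<delta>"
proof -
  have False if "\<And>y. norm y \<le> 1 \<Longrightarrow> blinfun_apply h y \<le> norm h - \<delta>"
  proof -
    \<comment> \<open>The origin lies in the ball, so the supposed bound is nonnegative, as an
      operator bound must be.\<close>
    have nn: "0 \<le> norm h - \<delta>"
      using that[of 0] by (simp add: blinfun.zero_right)
    have one_sided: "blinfun_apply h x \<le> (norm h - \<delta>) * norm x" for x
    proof (cases "x = 0")
      case False
      then have "blinfun_apply h (x /\<^sub>R norm x) \<le> norm h - \<delta>"
        by (intro that) simp
      then show ?thesis
        using False by (simp add: blinfun.scaleR_right field_simps)
    qed (simp add: blinfun.zero_right)
    have "norm (blinfun_apply h x) \<le> (norm h - \<delta>) * norm x" for x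
      using one_sided[of x] one_sided[of "- x"] by (simp add: blinfun.minus_right)
    then have "norm h \<le> norm h - \<delta>"
      using nn by (intro norm_blinfun_bound) auto
    with assms show False by simp
  qed
  then show thesis
    by (meson not_le that)
qed

lemma is_slice_subset_cball: "is_slice S \<Longrightarrow> S \<subseteq> cball 0 1"
  by (auto simp: is_slice_def slice_def)

lemma convex_combination_of_slices_subset_cball:
  assumes "is_convex_combination_of_slices C"
  shows "C \<subseteq> cball 0 1"
proof
  fix z assume "z \<in> C"
  with assms obtain n c S x where
    S: "\<forall>i<n. is_slice (S i)" and c: "\<forall>i<(n::nat). 0 \<le> c i" "(\<Sum>i<n. c i) = (1::real)"
    and x: "\<forall>i<n. x i \<in> S i" and z: "z = (\<Sum>i<n. c i *\<^sub>R x i)"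
    unfolding is_convex_combination_of_slices_def by blast
  have "\<And>i. i < n \<Longrightarrow> x i \<in> cball 0 1"
    using S x is_slice_subset_cball by blast
  then show "z \<in> cball 0 1"
    unfolding z using c by (intro convex_sum) auto
qed

text \<open>One \<open>y\<close> serves all \<open>x\<close> in \<open>T\<close>; this uniformity is
  what turns the inclusion into one of a translate.\<close>

lemma slice_contains_translate:
  fixes j :: "'a::real_normed_vector \<Rightarrow> 'c::real_normed_vector"
    and k :: "'b::real_normed_vector \<Rightarrow> 'c"
  assumes j: "bounded_linear j" and k: "bounded_linear k"
    and norm_jk: "\<And>x y. norm (j x + k y) = max (norm x) (norm y)"
    and surj: "\<And>z. \<exists>x y. z = j x + k y"
    and "is_slice S"
  obtains T y where "is_slice T \<or> T = cball 0 1" "\<And>x. x \<in> T \<Longrightarrow> j x + k y \<in> S"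
proof -
  obtain f \<alpha> where f: "norm f = 1" and \<alpha>: "\<alpha> > 0" and S: "S = slice f \<alpha>"
    using assms(5) unfolding is_slice_def by blast
  define g where "g = f o\<^sub>L Blinfun j"
  define h where "h = f o\<^sub>L Blinfun k"
  have f_jk: "blinfun_apply f (j x + k y) = blinfun_apply g x + blinfun_apply h y" for x y
    by (simp add: g_def h_def bounded_linear_Blinfun_apply j k blinfun.add_right)
  \<comment> \<open>The max norm of \<open>z\<close> dominates both components, so
    \<open>norm g + norm h\<close> is an operator bound for \<open>f\<close>.\<close>
  have norm_gh: "1 \<le> norm g + norm h"
  proof -
    have "norm (blinfun_apply f z) \<le> (norm g + norm h) * norm z" for z
    proof -
      obtain x y where z: "z = j x + k y" using surj by blast
      have "norm (blinfun_apply f z) \<le> norm g * norm x + norm h * norm y"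
        unfolding z f_jk
        by (intro norm_triangle_mono norm_blinfun)
      also have "\<dots> \<le> norm g * norm z + norm h * norm z"
        unfolding z norm_jk by (intro add_mono mult_left_mono) auto
      finally show ?thesis by (simp add: algebra_simps)
    qed
    then show ?thesis
      using norm_blinfun_bound[of "norm g + norm h" f] f by simp
  qed
  obtain y where y: "norm y \<le> 1" "blinfun_apply h y > norm h - \<alpha> / 2"
    using blinfun_almost_attains_norm[of "\<alpha> / 2" h] \<alpha> by auto
  \<comment> \<open>The two losses of \<open>\<alpha> / 2\<close> add up: the value of
    \<open>f\<close> exceeds \<open>norm g + norm h - \<alpha>\<close>, hence
    \<open>1 - \<alpha>\<close>.\<close>
  have in_S: "j x + k y \<in> S" if "norm x \<le> 1" "blinfun_apply g x > norm g - \<alpha> / 2" for x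
    using that y norm_gh by (auto simp: S slice_def norm_jk f_jk)
  show thesis
  proof (cases "g = 0")
    case True
    show thesis
      by (rule that[of "cball 0 1" y]) (use in_S \<alpha> True in auto)
  next
    case False
    \<comment> \<open>This is the condition \<open>g x > norm g - \<alpha> / 2\<close> divided by
      \<open>norm g\<close>, so that the functional has norm 1.\<close>
    define T where "T = slice (g /\<^sub>R norm g) (\<alpha> / (2 * norm g))"
    have "is_slice T"
      unfolding is_slice_def T_def using False \<alpha>
      by (intro exI[of _ "g /\<^sub>R norm g"] exI[of _ "\<alpha> / (2 * norm g)"]) simp
    moreover have "j x + k y \<in> S" if "x \<in> T" for x
    proof (rule in_S)
      show "norm x \<le> 1"
        using that by (simp add: T_def slice_def)
      have "1 - \<alpha> / (2 * norm g) < inverse (norm g) * blinfun_apply g x"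
        using that by (simp add: T_def slice_def blinfun.scaleR_left)
      then have "norm g * (1 - \<alpha> / (2 * norm g)) < norm g * (inverse (norm g) * blinfun_apply g x)"
        using False by (intro mult_strict_left_mono) auto
      moreover have "norm g * (1 - \<alpha> / (2 * norm g)) = norm g - \<alpha> / 2"
        using False by (simp add: right_diff_distrib)
      moreover have "norm g * (inverse (norm g) * blinfun_apply g x) = blinfun_apply g x"
        using False by (simp add: mult.assoc[symmetric])
      ultimately show "norm g - \<alpha> / 2 < blinfun_apply g x"
        by simp
    qed
    ultimately show thesis using that by blast
  qed
qed

text \<open>Abstract embeddings \<open>j\<close> and \<open>k\<close> keep the roles of the summands
  exchangeable, so one argument covers both.\<close>

lemma BSCSP_max_norm_summand:
  fixes j :: "'a::real_normed_vector \<Rightarrow> 'c::real_normed_vector"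
    and k :: "'b::real_normed_vector \<Rightarrow> 'c"
  assumes j: "bounded_linear j" and k: "bounded_linear k"
    and norm_jk: "\<And>x y. norm (j x + k y) = max (norm x) (norm y)"
    and surj: "\<And>z. \<exists>x y. z = j x + k y"
    and nontrivial: "(UNIV :: 'a set) \<noteq> {0}"
    and bscsp: "BSCSP TYPE('c)"
  shows "BSCSP TYPE('a)"
  unfolding BSCSP_def
proof (intro allI impI)
  fix \<epsilon> :: real assume "\<epsilon> > 0"
  \<comment> \<open>The cap 1 serves the case without slices below, where the diameter is shown to
    be at least 2.\<close>
  then obtain C :: "'c set" where C: "is_convex_combination_of_slices C" "diameter C < min \<epsilon> 1"
    using bscsp unfolding BSCSP_def by (metis min_less_iff_conj zero_less_one)
  have bounded_C: "bounded C"
    using convex_combination_of_slices_subset_cball[OF C(1)] bounded_cball bounded_subset by blast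
  obtain n c S where S: "\<forall>i<n. is_slice (S i)"
    and c: "\<forall>i<(n::nat). 0 \<le> c i" "(\<Sum>i<n. c i) = (1::real)"
    and C_eq: "C = {\<Sum>i<n. c i *\<^sub>R z i | z. \<forall>i<n. z i \<in> S i}"
    using C(1) unfolding is_convex_combination_of_slices_def by blast
  have "\<forall>i. \<exists>T y. i < n \<longrightarrow> (is_slice T \<or> T = cball 0 1) \<and> (\<forall>x\<in>T. j x + k y \<in> S i)"
    using S slice_contains_translate[OF j k norm_jk surj] by metis
  then obtain T y where T: "\<And>i. i < n \<Longrightarrow> is_slice (T i) \<or> T i = cball 0 1"
    and Ty: "\<And>i x. i < n \<Longrightarrow> x \<in> T i \<Longrightarrow> j x + k (y i) \<in> S i"
    by metis
  have norm_j: "norm (j x) = norm x" for x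
    using norm_jk[of x 0] linear_0[OF bounded_linear.linear[OF k]] by simp
  \<comment> \<open>Adding \<open>k (y i)\<close> to each \<open>j (u i)\<close> and
    \<open>j (v i)\<close> gives two points of \<open>C\<close>; the common translation cancels in
    their difference and \<open>j\<close> is isometric.\<close>
  have dist_le: "norm ((\<Sum>i<n. c i *\<^sub>R u i) - (\<Sum>i<n. c i *\<^sub>R v i)) \<le> diameter C"
    if uv: "\<And>i. i < n \<Longrightarrow> u i \<in> T i" "\<And>i. i < n \<Longrightarrow> v i \<in> T i" for u v
  proof -
    let ?p = "\<lambda>u. \<Sum>i<n. c i *\<^sub>R (j (u i) + k (y i))"
    have "?p w \<in> C" if "\<And>i. i < n \<Longrightarrow> w i \<in> T i" for w
      unfolding C_eq using that Ty
      by (intro CollectI exI[of _ "\<lambda>i. j (w i) + k (y i)"]) simp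
    then have "?p u \<in> C" "?p v \<in> C"
      using uv by simp_all
    then have "dist (?p u) (?p v) \<le> diameter C"
      using diameter_bounded_bound[OF bounded_C] by blast
    moreover have "?p u - ?p v = j ((\<Sum>i<n. c i *\<^sub>R u i) - (\<Sum>i<n. c i *\<^sub>R v i))"
      using bounded_linear.linear[OF j]
      by (simp add: linear_diff linear_sum linear_scale scaleR_add_right sum.distrib)
    ultimately show ?thesis
      by (simp add: dist_norm norm_j)
  qed
  show "\<exists>D :: 'a set. is_convex_combination_of_slices D \<and> diameter D < \<epsilon>"
  proof (cases "\<exists>T :: 'a set. is_slice T")
    case True
    then obtain T0 :: "'a set" where T0: "is_slice T0" by blast
    \<comment> \<open>Where \<open>T i\<close> is the whole ball, any slice \<open>T0\<close> is a
      subset of it, so the replacement keeps \<open>dist_le\<close> applicable.\<close>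
    define U where "U i = (if is_slice (T i) then T i else T0)" for i
    have U: "is_slice (U i)" for i
      using T0 by (simp add: U_def)
    have U_T: "U i \<subseteq> T i" if "i < n" for i
      using T[OF that] is_slice_subset_cball[OF T0] by (auto simp: U_def)
    define D where "D = {\<Sum>i<n. c i *\<^sub>R x i | x. \<forall>i<n. x i \<in> U i}"
    have "is_convex_combination_of_slices D"
      unfolding is_convex_combination_of_slices_def D_def using U c
      by (intro exI[of _ n] exI[of _ c] exI[of _ U]) simp
    moreover have "diameter D \<le> diameter C"
    proof (rule diameter_le)
      fix p q assume "p \<in> D" "q \<in> D"
      then obtain u v where "\<forall>i<n. u i \<in> U i" "\<forall>i<n. v i \<in> U i"
        and pq: "p = (\<Sum>i<n. c i *\<^sub>R u i)" "q = (\<Sum>i<n. c i *\<^sub>R v i)"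
        unfolding D_def by blast
      then show "norm (p - q) \<le> diameter C"
        unfolding pq using U_T by (intro dist_le) blast+
    qed (simp add: diameter_ge_0[OF bounded_C])
    ultimately show ?thesis using C(2) by fastforce
  next
    case False
    obtain w :: 'a where "w \<noteq> 0" using nontrivial by blast
    define u where "u = w /\<^sub>R norm w"
    have u: "norm u = 1" using \<open>w \<noteq> 0\<close> by (simp add: u_def)
    \<comment> \<open>With no slices available every \<open>T i\<close> is the unit ball and
      contains both \<open>u\<close> and \<open>- u\<close>. Their distance 2 contradicts
      \<open>diameter C < 1\<close>.\<close>
    have "norm ((\<Sum>i<n. c i *\<^sub>R u) - (\<Sum>i<n. c i *\<^sub>R (- u))) \<le> diameter C"
      using T False u by (intro dist_le) auto
    moreover have "(\<Sum>i<n. c i *\<^sub>R u) - (\<Sum>i<n. c i *\<^sub>R (- u)) = 2 *\<^sub>R u"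
      by (simp only: scaleR_left.sum[symmetric] c(2)) (simp add: scaleR_2)
    ultimately show ?thesis using C(2) u by simp
  qed
qed

theorem proposition2p15:
  assumes "(UNIV :: 'a::banach set) \<noteq> {0}"
    and "(UNIV :: 'b::banach set) \<noteq> {0}"
    and "BSCSP TYPE(('a, 'b) linf_sum)"
  shows "BSCSP TYPE('a) \<and> BSCSP TYPE('b)"
proof -
  let ?j = "\<lambda>x::'a. Linf x (0::'b)" and ?k = "\<lambda>y::'b. Linf (0::'a) y"
  have j: "bounded_linear ?j"
    by (rule bounded_linear_intro[where K = 1])
      (simp_all add: plus_linf_sum_def scaleR_linf_sum_def norm_linf_sum_def)
  have k: "bounded_linear ?k"
    by (rule bounded_linear_intro[where K = 1])
      (simp_all add: plus_linf_sum_def scaleR_linf_sum_def norm_linf_sum_def)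
  have norm_jk: "norm (?j x + ?k y) = max (norm x) (norm y)" for x y
    by (simp add: norm_linf_sum_def)
  have surj: "\<exists>x y. z = ?j x + ?k y" for z
    by (cases z) (simp add: plus_linf_sum_def)
  \<comment> \<open>The same facts with the embeddings exchanged, for the second summand.\<close>
  have norm_kj: "norm (?k y + ?j x) = max (norm y) (norm x)" for x y
    by (simp add: norm_linf_sum_def max.commute)
  have surj': "\<exists>y x. z = ?k y + ?j x" for z
    by (cases z) (simp add: plus_linf_sum_def)
  show ?thesis
    using BSCSP_max_norm_summand[OF j k norm_jk surj assms(1,3)]
      BSCSP_max_norm_summand[OF k j norm_kj surj' assms(2,3)] by blast
qed

end
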